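(* There exist a strictly stationary ergodic sequence $(X_i)_{i\geq 1}$ of real-valued random variables and a bounded measurable symmetric function $h\colon\mathbb{R}^2\to\mathbb{R}$ such that the sequence $$\left(\binom{n}{2}^{-1}\sum_{1\leq i<j\leq n}h(X_i,X_j)\right)_{n\geq 2}$$ does not converge in probability.
   Context: "Symmetric" means $h(x,y)=h(y,x)$ for all $x,y\in\mathbb{R}$. "Does not converge in probability" means that there is no random variable to which the sequence converges in probability. *)

theory Defs
  imports "HOL-Probability.Probability"
begin

text \<open>Sequences \<open>(X\<^sub>i)\<close> are indexed by \<open>i \<ge> 1\<close>, so trajectories live in the product over \<open>{1..}\<close>;
  the value \<open>X 0\<close> of a HOL sequence never plays a role.\<close>

definition trajectory_space :: "(nat \<Rightarrow> real) measure" where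
  "trajectory_space = (\<Pi>\<^sub>M i\<in>{1..}. borel)"

definition trajectory :: "(nat \<Rightarrow> 'a \<Rightarrow> real) \<Rightarrow> 'a \<Rightarrow> nat \<Rightarrow> real" where
  "trajectory X \<omega> = (\<lambda>i\<in>{1..}. X i \<omega>)"

definition shift :: "(nat \<Rightarrow> real) \<Rightarrow> nat \<Rightarrow> real" where
  "shift x = (\<lambda>i\<in>{1..}. x (i + 1))"

definition random_sequence :: "'a measure \<Rightarrow> (nat \<Rightarrow> 'a \<Rightarrow> real) \<Rightarrow> bool" where
  "random_sequence M X \<longleftrightarrow> (\<forall>i\<ge>1. X i \<in> borel_measurable M)"

definition strictly_stationary :: "'a measure \<Rightarrow> (nat \<Rightarrow> 'a \<Rightarrow> real) \<Rightarrow> bool" where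
  "strictly_stationary M X \<longleftrightarrow>
     (\<forall>k. distr M trajectory_space (trajectory (\<lambda>i. X (i + k))) =
          distr M trajectory_space (trajectory X))"

definition ergodic_sequence :: "'a measure \<Rightarrow> (nat \<Rightarrow> 'a \<Rightarrow> real) \<Rightarrow> bool" where
  "ergodic_sequence M X \<longleftrightarrow>
     (\<forall>A \<in> sets trajectory_space. shift -` A \<inter> space trajectory_space = A \<longrightarrow>
        measure M {\<omega> \<in> space M. trajectory X \<omega> \<in> A} \<in> {0, 1})"

text \<open>For \<open>n < 2\<close> the value is \<open>0\<close> by the convention \<open>x / 0 = 0\<close>; these terms do not
  affect convergence.\<close>

definition U_statistic :: "(real \<Rightarrow> real \<Rightarrow> real) \<Rightarrow> (nat \<Rightarrow> 'a \<Rightarrow> real) \<Rightarrow> nat \<Rightarrow> 'a \<Rightarrow> real" where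
  "U_statistic h X n \<omega> =
     (\<Sum>(i, j) \<in> {(i, j). 1 \<le> i \<and> i < j \<and> j \<le> n}. h (X i \<omega>) (X j \<omega>)) / real (n choose 2)"

definition tendsto_in_probability ::
    "'a measure \<Rightarrow> (nat \<Rightarrow> 'a \<Rightarrow> real) \<Rightarrow> ('a \<Rightarrow> real) \<Rightarrow> bool" where
  "tendsto_in_probability M Y Z \<longleftrightarrow>
     (\<forall>\<epsilon>>0. (\<lambda>n. measure M {\<omega> \<in> space M. \<bar>Y n \<omega> - Z \<omega>\<bar> > \<epsilon>}) \<longlonglongrightarrow> 0)"

text \<open>The \<open>distr\<close> and \<open>measure\<close> terms above are meaningful only for measurable arguments.\<close>

lemma measurable_trajectory:
  assumes "random_sequence M X"
  shows "trajectory X \<in> measurable M trajectory_space"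
    and "trajectory (\<lambda>i. X (i + k)) \<in> measurable M trajectory_space"
  using assms unfolding trajectory_def[abs_def] trajectory_space_def random_sequence_def
  by (auto intro!: measurable_restrict)

lemma measurable_shift: "shift \<in> measurable trajectory_space trajectory_space"
  unfolding shift_def[abs_def] trajectory_space_def
  by (intro measurable_restrict measurable_component_singleton) auto

end

theory Submission
  imports Defs
begin

text \<open>Let \<open>U\<close> be uniform on \<open>[0, 1)\<close> and let \<open>X\<^sub>i\<close> be the fractional part of \<open>2 ^ i * U\<close>, an orbit of
  the doubling map. For irrational \<open>U\<close> the pair \<open>(X\<^sub>i, X\<^sub>j)\<close> determines \<open>j - i\<close>: the number
  \<open>X\<^sub>j - 2 ^ d * X\<^sub>i\<close> is an integer only for \<open>d = j - i\<close>. Hence for any set \<open>S\<close> of positive integers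
  there is a kernel \<open>h\<close> with \<open>h (X\<^sub>i, X\<^sub>j) = 1\<close> exactly when \<open>\<bar>j - i\<bar> \<in> S\<close>, and its U-statistic is almost
  surely the deterministic proportion of pairs with difference in \<open>S\<close>. Taking for \<open>S\<close> the
  numbers with an odd number of decimal digits makes this proportion oscillate.
  Ergodicity: if \<open>B \<subseteq> \<real>\<close> is invariant under \<open>x \<mapsto> x + 1\<close> and \<open>x \<mapsto> 2 * x\<close>, then scaling shows
  that \<open>B\<close> has the same relative measure \<open>c\<close> in every interval, so Lebesgue measure restricted
  to \<open>B\<close> is \<open>c\<close> times Lebesgue measure, which forces \<open>c \<in> {0, 1}\<close>.\<close>

section \<open>Lebesgue measure of sets with period 1\<close>

lemma fmeasurable_lborel_bounded:
  assumes "A \<in> sets borel" "bounded (A :: real set)"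
  shows "A \<in> fmeasurable lborel"
  using assms emeasure_bounded_finite[OF assms(2)] by (intro fmeasurableI) auto

lemma measure_lborel_affine:
  fixes c t :: real
  assumes "c \<noteq> 0" and [measurable]: "A \<in> sets borel"
  shows "measure lborel A = \<bar>c\<bar> * measure lborel {x. t + c * x \<in> A}"
proof -
  have "emeasure lborel A = (\<integral>\<^sup>+x. indicator A x \<partial>lborel)"
    by simp
  also have "\<dots> = \<bar>c\<bar> * (\<integral>\<^sup>+x. indicator A (t + c * x) \<partial>lborel)"
    using assms by (intro nn_integral_real_affine) auto
  also have "(\<integral>\<^sup>+x. indicator A (t + c * x) \<partial>lborel)
      = (\<integral>\<^sup>+x. indicator {x. t + c * x \<in> A} x \<partial>lborel)"
    by (intro nn_integral_cong) (auto simp: indicator_def)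
  also have "\<dots> = emeasure lborel {x. t + c * x \<in> A}"
    by (intro nn_integral_indicator) measurable
  finally show ?thesis
    by (simp add: measure_def enn2real_mult)
qed

lemma periodic_add_int:
  fixes x :: real
  assumes per: "\<And>x. x + 1 \<in> B \<longleftrightarrow> x \<in> B"
  shows "x + of_int k \<in> B \<longleftrightarrow> x \<in> B"
proof (induction k rule: int_induct[where k = 0])
  case (step1 i)
  then show ?case using per[of "x + of_int i"] by (simp add: add.assoc)
next
  case (step2 i)
  then show ?case using per[of "x + of_int (i - 1)"] by (simp add: algebra_simps)
qed simp

text \<open>A unit interval with integer left end meets \<open>B\<close> in an integer translate of
  \<open>{0..<1} \<inter> B\<close>, and the induction adds one such interval at a time.\<close>

lemma measure_periodic_Ico:
  fixes B :: "real set"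
  assumes per: "\<And>x. x + 1 \<in> B \<longleftrightarrow> x \<in> B" and [measurable]: "B \<in> sets borel"
  shows "measure lborel ({of_int j..<of_int j + real n} \<inter> B) = real n * measure lborel ({0..<1} \<inter> B)"
proof (induction n)
  case (Suc n)
  let ?a = "of_int j + real n"
  have "measure lborel ({?a..<?a + 1} \<inter> B)
      = measure lborel {x. ?a + 1 * x \<in> {?a..<?a + 1} \<inter> B}"
    using measure_lborel_affine[of 1 "{?a..<?a + 1} \<inter> B" ?a] by simp
  also have "{x. ?a + 1 * x \<in> {?a..<?a + 1} \<inter> B} = {0..<1} \<inter> B"
    using periodic_add_int[OF per, of _ "j + int n"] by (auto simp: algebra_simps)
  finally have unit: "measure lborel ({?a..<?a + 1} \<inter> B) = measure lborel ({0..<1} \<inter> B)" .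
  have split: "{of_int j..<of_int j + real (Suc n)} \<inter> B
      = ({of_int j..<?a} \<inter> B) \<union> ({?a..<?a + 1} \<inter> B)"
    by auto
  have "measure lborel ({of_int j..<of_int j + real (Suc n)} \<inter> B)
      = measure lborel ({of_int j..<?a} \<inter> B) + measure lborel ({?a..<?a + 1} \<inter> B)"
    unfolding split
    by (rule measure_Un_AE[OF AE_I2]) (auto intro!: fmeasurable_lborel_bounded bounded_Int)
  then show ?case
    unfolding Suc unit by (simp add: algebra_simps)
qed simp

text \<open>Scaling by \<open>2 ^ k\<close> turns one period into \<open>2 ^ k\<close> periods, and
  this factor cancels the Jacobian. So the doubling map preserves Lebesgue measure on
  \<open>{0..<1}\<close>, which later yields stationarity.\<close>

lemma measure_periodic_power:
  fixes B :: "real set"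
  assumes per: "\<And>x. x + 1 \<in> B \<longleftrightarrow> x \<in> B" and [measurable]: "B \<in> sets borel"
  shows "measure lborel ({0..<1} \<inter> {x. 2 ^ k * x \<in> B}) = measure lborel ({0..<1} \<inter> B)"
proof -
  have "2 ^ k * measure lborel ({0..<1} \<inter> B) = measure lborel ({0..<2 ^ k} \<inter> B)"
    using measure_periodic_Ico[OF assms, of 0 "2 ^ k"] by simp
  also have "\<dots> = 2 ^ k * measure lborel {x. 0 + 2 ^ k * x \<in> {0..<2 ^ k} \<inter> B}"
    using measure_lborel_affine[of "2 ^ k" "{0..<2 ^ k} \<inter> B" 0] by simp
  also have "{x. 0 + 2 ^ k * x \<in> {0..<2 ^ k} \<inter> B} = {0..<1} \<inter> {x. 2 ^ k * x \<in> B}"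
    by (auto simp: zero_le_mult_iff not_le[THEN iffD2, OF zero_less_power])
  finally show ?thesis by simp
qed

lemma measure_periodic_le:
  fixes B :: "real set"
  assumes per: "\<And>x. x + 1 \<in> B \<longleftrightarrow> x \<in> B" and [measurable]: "B \<in> sets borel" and "l \<le> u"
  shows "measure lborel ({l<..<u} \<inter> B) \<le> (u - l + 2) * measure lborel ({0..<1} \<inter> B)"
proof -
  \<comment> \<open>The number of unit intervals that cover \<open>{l<..<u}\<close> after rounding
    to integer ends. Each end costs at most 1, hence the \<open>+ 2\<close> in the bound.\<close>
  define n where "n = nat (\<lfloor>u\<rfloor> + 1 - \<lfloor>l\<rfloor>)"
  have n: "real n = of_int \<lfloor>u\<rfloor> + 1 - of_int \<lfloor>l\<rfloor>"
    using floor_mono[OF \<open>l \<le> u\<close>] by (simp add: n_def)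
  have "measure lborel ({l<..<u} \<inter> B) \<le> measure lborel ({of_int \<lfloor>l\<rfloor>..<of_int \<lfloor>l\<rfloor> + real n} \<inter> B)"
  proof (rule measure_mono_fmeasurable)
    show "{l<..<u} \<inter> B \<subseteq> {of_int \<lfloor>l\<rfloor>..<of_int \<lfloor>l\<rfloor> + real n} \<inter> B"
      unfolding n by (auto; linarith)
  qed (auto intro!: fmeasurable_lborel_bounded bounded_Int)
  also have "\<dots> = real n * measure lborel ({0..<1} \<inter> B)"
    using assms by (intro measure_periodic_Ico) auto
  also have "\<dots> \<le> (u - l + 2) * measure lborel ({0..<1} \<inter> B)"
    unfolding n by (intro mult_right_mono) (linarith, simp)
  finally show ?thesis .
qed

section \<open>Ergodicity of the doubling map on the real line\<close>

lemma double_invariant_power: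
  fixes x :: real
  assumes "\<And>x. 2 * x \<in> B \<longleftrightarrow> x \<in> B"
  shows "2 ^ N * x \<in> B \<longleftrightarrow> x \<in> B"
  using assms[of "2 ^ n * x" for n] by (induction N) (auto simp: mult.assoc)

text \<open>Blowing the interval up by \<open>2 ^ N\<close> divides the boundary error of
  \<open>measure_periodic_le\<close> by \<open>2 ^ N\<close>.\<close>

lemma measure_invariant_le:
  fixes B :: "real set"
  assumes per: "\<And>x. x + 1 \<in> B \<longleftrightarrow> x \<in> B" and dbl: "\<And>x. 2 * x \<in> B \<longleftrightarrow> x \<in> B"
    and [measurable]: "B \<in> sets borel" and "l \<le> u"
  shows "measure lborel ({l<..<u} \<inter> B) \<le> (u - l) * measure lborel ({0..<1} \<inter> B)"
proof -
  let ?c = "measure lborel ({0..<1} \<inter> B)"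
  have bound: "measure lborel ({l<..<u} \<inter> B) \<le> (u - l) * ?c + 2 * ?c * (1 / 2) ^ N" for N
  proof -
    have "measure lborel ({l<..<u} \<inter> B)
        = 1 / 2 ^ N * measure lborel {x. 0 + 1 / 2 ^ N * x \<in> {l<..<u} \<inter> B}"
      using measure_lborel_affine[of "1 / 2 ^ N" "{l<..<u} \<inter> B" 0] by simp
    \<comment> \<open>Dilation by \<open>2 ^ N\<close> leaves \<open>B\<close> unchanged and
      stretches only the interval.\<close>
    also have "{x. 0 + 1 / 2 ^ N * x \<in> {l<..<u} \<inter> B} = {2 ^ N * l<..<2 ^ N * u} \<inter> B"
      using double_invariant_power[OF dbl, of N "x / 2 ^ N" for x] by (auto simp: field_simps)
    also have "1 / 2 ^ N * measure lborel \<dots> \<le> 1 / 2 ^ N * ((2 ^ N * u - 2 ^ N * l + 2) * ?c)"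
      using assms by (intro mult_left_mono measure_periodic_le) auto
    also have "\<dots> = (u - l) * ?c + 2 * ?c * (1 / 2) ^ N"
      by (simp add: field_simps power_divide)
    finally show ?thesis .
  qed
  have "(\<lambda>N. (u - l) * ?c + 2 * ?c * (1 / 2) ^ N) \<longlonglongrightarrow> (u - l) * ?c + 2 * ?c * 0"
    by (intro tendsto_intros) auto
  then show ?thesis
    using bound by (intro LIMSEQ_le_const) auto
qed

lemma measure_Int_Compl:
  assumes "A \<in> fmeasurable M" "B \<in> sets M"
  shows "measure M (A \<inter> - B) = measure M A - measure M (A \<inter> B)"
proof -
  have "A \<inter> - B = A - A \<inter> B" by auto
  then show ?thesis
    using assms measurable_measure_Diff[of A M "A \<inter> B"] by (simp add: fmeasurableD sets.Int)
qed

text \<open>The complement of \<open>B\<close> satisfies the same invariances, so its upper bound is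
  the missing lower bound for \<open>B\<close>.\<close>

lemma measure_invariant_eq:
  fixes B :: "real set"
  assumes per: "\<And>x. x + 1 \<in> B \<longleftrightarrow> x \<in> B" and dbl: "\<And>x. 2 * x \<in> B \<longleftrightarrow> x \<in> B"
    and B[measurable]: "B \<in> sets borel" and "l \<le> u"
  shows "measure lborel ({l<..<u} \<inter> B) = (u - l) * measure lborel ({0..<1} \<inter> B)"
proof (rule antisym)
  show "measure lborel ({l<..<u} \<inter> B) \<le> (u - l) * measure lborel ({0..<1} \<inter> B)"
    by (rule measure_invariant_le[OF assms])
  have compl: "measure lborel ({l<..<u} \<inter> - B) = (u - l) - measure lborel ({l<..<u} \<inter> B)"
      "measure lborel ({0..<1} \<inter> - B) = 1 - measure lborel ({0..<1} \<inter> B)"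
    using \<open>l \<le> u\<close> B by (auto simp: measure_Int_Compl fmeasurable_lborel_bounded)
  have "measure lborel ({l<..<u} \<inter> - B) \<le> (u - l) * measure lborel ({0..<1} \<inter> - B)"
    using assms by (intro measure_invariant_le) auto
  then show "(u - l) * measure lborel ({0..<1} \<inter> B) \<le> measure lborel ({l<..<u} \<inter> B)"
    unfolding compl by (simp add: algebra_simps)
qed

lemma doubling_ergodic:
  fixes B :: "real set"
  assumes per: "\<And>x. x + 1 \<in> B \<longleftrightarrow> x \<in> B" and dbl: "\<And>x. 2 * x \<in> B \<longleftrightarrow> x \<in> B"
    and B[measurable]: "B \<in> sets borel"
  shows "measure lborel ({0..<1} \<inter> B) \<in> {0, 1}"
proof (cases "measure lborel ({0..<1} \<inter> B) = 0")
  case False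
  define c where "c = measure lborel ({0..<1} \<inter> B)"
  have "c > 0" using False by (simp add: c_def zero_less_measure_iff)
  \<comment> \<open>Lebesgue measure restricted to \<open>B\<close>, normalised so that it agrees
    with \<open>lborel\<close> on intervals and hence everywhere. It has no mass outside
    \<open>B\<close>, so the complement of \<open>B\<close> is a null set.\<close>
  define \<nu> where "\<nu> = density lborel (\<lambda>x. ennreal (1 / c) * indicator B x)"
  have \<nu>: "emeasure \<nu> A = ennreal (1 / c) * emeasure lborel (A \<inter> B)" if [measurable]: "A \<in> sets borel" for A
  proof -
    have "emeasure \<nu> A = (\<integral>\<^sup>+x. ennreal (1 / c) * indicator (A \<inter> B) x \<partial>lborel)"
      by (auto simp: \<nu>_def emeasure_density indicator_def intro!: nn_integral_cong)
    then show ?thesis by (simp add: nn_integral_cmult)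
  qed
  have "lborel = \<nu>"
  proof (rule lborel_eqI)
    fix l u :: real
    assume "\<And>b. b \<in> Basis \<Longrightarrow> l \<bullet> b \<le> u \<bullet> b"
    then have "l \<le> u" by simp
    have fm: "{l<..<u} \<inter> B \<in> fmeasurable lborel"
      by (auto intro!: fmeasurable_lborel_bounded bounded_Int)
    have "emeasure \<nu> (box l u) = ennreal (1 / c) * ennreal ((u - l) * c)"
      using measure_invariant_eq[OF assms \<open>l \<le> u\<close>] emeasure_eq_measure2[OF fm]
      by (simp add: \<nu> box_real c_def)
    also have "\<dots> = ennreal (u - l)"
      using \<open>c > 0\<close> \<open>l \<le> u\<close> by (subst ennreal_mult[symmetric]) auto
    finally show "emeasure \<nu> (box l u) = (\<Prod>b\<in>Basis. (u - l) \<bullet> b)"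
      by simp
  qed (simp add: \<nu>_def)
  then have "emeasure lborel ({0..<1} \<inter> - B) = emeasure \<nu> ({0..<1} \<inter> - B)"
    by simp
  also have "\<dots> = 0"
    by (subst \<nu>) (auto simp: Int_assoc)
  finally have "measure lborel ({0..<1} \<inter> - B) = 0"
    by (simp add: measure_def)
  then show ?thesis
    using B by (simp add: measure_Int_Compl fmeasurable_lborel_bounded)
qed simp

section \<open>Density of pairs whose difference lies in alternating decades\<close>

definition blocks :: "nat set" where
  "blocks = (\<Union>k. {10 ^ (2 * k)..<10 ^ (2 * k + 1)})"

definition pairs :: "nat \<Rightarrow> (nat \<times> nat) set" where
  "pairs n = {(i, j). 1 \<le> i \<and> i < j \<and> j \<le> n}"

lemma finite_pairs [simp]: "finite (pairs n)"
  by (rule finite_subset[of _ "{..n} \<times> {..n}"]) (auto simp: pairs_def)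

lemma card_pairs: "card (pairs n) = n choose 2"
proof (induction n)
  case 0
  have "pairs 0 = {}" by (auto simp: pairs_def)
  then show ?case by simp
next
  case (Suc n)
  have "pairs (Suc n) = pairs n \<union> (\<lambda>i. (i, Suc n)) ` {1..n}"
    by (auto simp: pairs_def)
  moreover have "card \<dots> = card (pairs n) + n"
    by (subst card_Un_disjoint) (auto simp: card_image inj_on_def, auto simp: pairs_def)
  ultimately show ?case using Suc by (simp add: numeral_2_eq_2)
qed

text \<open>A pair is determined by its first entry and its difference; truncated subtraction is
  harmless because \<open>i < j\<close> on \<open>pairs n\<close>.\<close>

lemma card_close_pairs: "card {(i, j) \<in> pairs n. j - i < m} \<le> n * m"
proof -
  have "card {(i, j) \<in> pairs n. j - i < m} \<le> card ({1..n} \<times> {..<m})"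
    by (rule card_inj_on_le[where f = "\<lambda>(i, j). (i, j - i)"])
      (auto simp: pairs_def inj_on_def)
  then show ?thesis by simp
qed

text \<open>Decades are disjoint: comparing powers of ten forces \<open>k = 2 * l\<close> for the
  block that contains \<open>d\<close>.\<close>

lemma blocks_decade:
  assumes "10 ^ k \<le> d" "d < 10 ^ (k + 1)"
  shows "d \<in> blocks \<longleftrightarrow> even k"
proof
  assume "even k"
  then show "d \<in> blocks"
    using assms by (auto simp: blocks_def elim!: evenE)
next
  assume "d \<in> blocks"
  then obtain l where l: "10 ^ (2 * l) \<le> d" "d < 10 ^ (2 * l + 1)"
    by (auto simp: blocks_def)
  have "(10 :: nat) ^ k < 10 ^ (2 * l + 1)" "(10 :: nat) ^ (2 * l) < 10 ^ (k + 1)"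
    using assms l by linarith+
  then have "k < 2 * l + 1" "2 * l < k + 1"
    by (simp_all only: power_strict_increasing_iff)
  then have "k = 2 * l" by simp
  then show "even k" by simp
qed

definition block_density :: "nat \<Rightarrow> real" where
  "block_density n = real (card {(i, j) \<in> pairs n. j - i \<in> blocks}) / real (n choose 2)"

text \<open>Differences below \<open>n / 10\<close> occur in at most \<open>n ^ 2 / 10\<close> of
  roughly \<open>n ^ 2 / 2\<close> pairs, a share near \<open>1 / 5\<close>. The value
  \<open>1 / 4\<close> leaves room for the lower-order term, even at \<open>k = 0\<close>.\<close>

lemma close_pairs_density:
  defines "n k \<equiv> 10 ^ Suc k :: nat"
  shows "real (card {(i, j) \<in> pairs (n k). j - i < 10 ^ k}) \<le> real (n k choose 2) / 4"
proof -
  have "real (card {(i, j) \<in> pairs (n k). j - i < 10 ^ k}) \<le> real (n k * 10 ^ k)"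
    using card_close_pairs by (simp only: of_nat_le_iff)
  also have "\<dots> \<le> real (n k choose 2) / 4"
  proof -
    \<comment> \<open>Parity makes the integer division in \<open>choose_two\<close> exact.\<close>
    have "even (n k * (n k - 1))" by (simp add: n_def)
    then have "2 * real (n k choose 2) = real (n k * (n k - 1))"
      unfolding choose_two by (metis dvd_mult_div_cancel of_nat_mult of_nat_numeral)
    also have "\<dots> = real (n k) * (10 * 10 ^ k - 1)"
      by (simp add: n_def of_nat_diff)
    finally have "real (n k choose 2) / 4 = real (n k) * ((10 * 10 ^ k - 1) / 8)"
      by simp
    moreover have "(10 ^ k :: real) \<le> (10 * 10 ^ k - 1) / 8"
      using one_le_power[of "10 :: real" k] by (simp; linarith)
    then have "real (n k) * 10 ^ k \<le> real (n k) * ((10 * 10 ^ k - 1) / 8)"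
      by (rule mult_left_mono) simp
    ultimately show ?thesis by simp
  qed
  finally show ?thesis .
qed

text \<open>The top decade of differences, from \<open>10 ^ k\<close> on, misses
  \<open>blocks\<close> when \<open>k\<close> is odd, so only close pairs can be counted.\<close>

lemma block_density_odd:
  assumes "odd k"
  shows "block_density (10 ^ Suc k) \<le> 1 / 4"
proof -
  let ?n = "10 ^ Suc k :: nat"
  have "{(i, j) \<in> pairs ?n. j - i \<in> blocks} \<subseteq> {(i, j) \<in> pairs ?n. j - i < 10 ^ k}"
  proof clarify
    fix i j assume ij: "(i, j) \<in> pairs ?n" "j - i \<in> blocks"
    then have "j - i < 10 ^ (k + 1)" by (auto simp: pairs_def)
    then show "j - i < 10 ^ k"
      using blocks_decade[of k "j - i"] ij assms by (metis not_less)
  qed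
  then have "card {(i, j) \<in> pairs ?n. j - i \<in> blocks} \<le> card {(i, j) \<in> pairs ?n. j - i < 10 ^ k}"
    by (intro card_mono finite_subset[OF _ finite_pairs[of ?n]]) auto
  then have "real (card {(i, j) \<in> pairs ?n. j - i \<in> blocks}) \<le> real (?n choose 2) / 4"
    using close_pairs_density[of k] by linarith
  moreover have "?n choose 2 > 0"
    using one_le_power[of "10 :: nat" k] by (intro zero_less_binomial) auto
  ultimately show ?thesis
    unfolding block_density_def by (simp add: field_simps del: power_Suc)
qed

text \<open>Now the top decade lies in \<open>blocks\<close>, so at most the close pairs are
  lost.\<close>

lemma block_density_even:
  assumes "even k"
  shows "block_density (10 ^ Suc k) \<ge> 3 / 4"
proof -
  let ?n = "10 ^ Suc k :: nat"
  have "pairs ?n \<subseteq> {(i, j) \<in> pairs ?n. j - i \<in> blocks} \<union> {(i, j) \<in> pairs ?n. j - i < 10 ^ k}"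
  proof clarify
    fix i j assume ij: "(i, j) \<in> pairs ?n" "\<not> j - i < 10 ^ k"
    then have "j - i < 10 ^ (k + 1)" by (auto simp: pairs_def)
    then show "j - i \<in> blocks"
      using blocks_decade[of k "j - i"] ij assms by (metis not_less)
  qed
  then have "card (pairs ?n)
      \<le> card ({(i, j) \<in> pairs ?n. j - i \<in> blocks} \<union> {(i, j) \<in> pairs ?n. j - i < 10 ^ k})"
    by (intro card_mono finite_subset[OF _ finite_pairs[of ?n]]) auto
  also have "\<dots> \<le> card {(i, j) \<in> pairs ?n. j - i \<in> blocks} + card {(i, j) \<in> pairs ?n. j - i < 10 ^ k}"
    by (rule card_Un_le)
  finally have "real (?n choose 2) * 3 / 4 \<le> real (card {(i, j) \<in> pairs ?n. j - i \<in> blocks})"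
    using close_pairs_density[of k] by (simp add: card_pairs)
  moreover have "?n choose 2 > 0"
    using one_le_power[of "10 :: nat" k] by (intro zero_less_binomial) auto
  ultimately show ?thesis
    unfolding block_density_def by (simp add: field_simps del: power_Suc)
qed

section \<open>A symmetric kernel that recovers index differences from orbit points\<close>

definition orbit_coordinate :: "nat \<Rightarrow> real \<Rightarrow> real" where
  "orbit_coordinate i x = frac (2 ^ i * x)"

text \<open>The condition \<open>frac z = 0\<close> expresses that \<open>z\<close> is an integer.
  The disjunction over both orders makes the kernel symmetric.\<close>

definition orbit_kernel :: "real \<Rightarrow> real \<Rightarrow> real" where
  "orbit_kernel x y = (if \<exists>d\<in>blocks. frac (y - 2 ^ d * x) = 0 \<or> frac (x - 2 ^ d * y) = 0 then 1 else 0)"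

text \<open>Up to an integer the difference is \<open>(2 ^ j - 2 ^ (d + i)) * x\<close>. If the
  coefficient were nonzero, integrality would make \<open>x\<close> rational.\<close>

lemma frac_orbit_coordinate_eq_0_iff:
  assumes "x \<notin> \<rat>"
  shows "frac (orbit_coordinate j x - 2 ^ d * orbit_coordinate i x) = 0 \<longleftrightarrow> j = d + i"
proof -
  have eq: "orbit_coordinate j x - 2 ^ d * orbit_coordinate i x
      = (2 ^ j - 2 ^ (d + i)) * x + of_int (2 ^ d * \<lfloor>2 ^ i * x\<rfloor> - \<lfloor>2 ^ j * x\<rfloor>)"
    by (simp add: orbit_coordinate_def frac_def algebra_simps power_add)
  have "frac (orbit_coordinate j x - 2 ^ d * orbit_coordinate i x) = 0
      \<longleftrightarrow> (2 ^ j - 2 ^ (d + i)) * x \<in> \<int>"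
    unfolding eq frac_eq_0_iff by (metis Ints_add Ints_diff Ints_of_int add_diff_cancel_right')
  also have "\<dots> \<longleftrightarrow> j = d + i"
  proof
    assume int: "(2 ^ j - 2 ^ (d + i)) * x \<in> \<int>"
    show "j = d + i"
    proof (rule ccontr)
      assume "j \<noteq> d + i"
      then have "(2 ^ j - 2 ^ (d + i) :: real) \<noteq> 0" by simp
      then have "x = (2 ^ j - 2 ^ (d + i)) * x / (2 ^ j - 2 ^ (d + i))" by simp
      moreover have "\<dots> \<in> \<rat>"
        using int Ints_subset_Rats by (intro Rats_divide Rats_diff Rats_power) auto
      ultimately show False using assms by simp
    qed
  qed simp
  finally show ?thesis .
qed

text \<open>As \<open>i < j\<close>, the exchanged alternative \<open>i = d + j\<close> is
  impossible, and the other one forces \<open>d = j - i\<close>.\<close>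

lemma orbit_kernel_orbit:
  assumes "x \<notin> \<rat>" "i < j"
  shows "orbit_kernel (orbit_coordinate i x) (orbit_coordinate j x) = (if j - i \<in> blocks then 1 else 0)"
proof -
  have "(\<exists>d\<in>blocks. j = d + i \<or> i = d + j) \<longleftrightarrow> j - i \<in> blocks"
    using assms(2) by (auto intro: bexI[of _ "j - i"])
  then show ?thesis
    using assms(1) by (simp only: orbit_kernel_def frac_orbit_coordinate_eq_0_iff not_False_eq_True)
qed

lemma measurable_frac [measurable]: "(frac :: real \<Rightarrow> real) \<in> borel_measurable borel"
  unfolding frac_def[abs_def] by measurable

lemma measurable_orbit_coordinate [measurable]: "orbit_coordinate i \<in> borel_measurable borel"
  unfolding orbit_coordinate_def[abs_def] by measurable

text \<open>The quantifier ranges over natural numbers, so the kernel is the indicator of a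
  countable union of measurable sets.\<close>

lemma measurable_orbit_kernel [measurable]:
  "(\<lambda>(x, y). orbit_kernel x y) \<in> borel_measurable (borel \<Otimes>\<^sub>M borel)"
  unfolding orbit_kernel_def by measurable

definition orbit :: "real \<Rightarrow> nat \<Rightarrow> real" where
  "orbit x = (\<lambda>i\<in>{1..}. orbit_coordinate i x)"

lemma measurable_orbit [measurable]: "orbit \<in> measurable borel trajectory_space"
  unfolding orbit_def[abs_def] trajectory_space_def by measurable

text \<open>Adding 1 changes \<open>2 ^ i * x\<close> by an integer. Hence preimages under
  \<open>orbit\<close> have period 1, as the measure lemmas require.\<close>

lemma orbit_add_1: "orbit (x + 1) = orbit x"
proof -
  have "frac (2 ^ i * (x + 1)) = frac (2 ^ i * x)" for i
    using frac_add_of_int_right[of "2 ^ i * x" "2 ^ i"] by (simp add: algebra_simps)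
  then show ?thesis by (simp add: orbit_def orbit_coordinate_def)
qed

lemma orbit_power: "orbit (2 ^ k * x) = (\<lambda>i\<in>{1..}. orbit_coordinate (i + k) x)"
  by (simp add: orbit_def orbit_coordinate_def power_add mult.assoc)

text \<open>Doubling raises every exponent by one. Thus a shift-invariant set pulls back to a set
  invariant under \<open>x \<mapsto> 2 * x\<close>, the situation of
  \<open>doubling_ergodic\<close>.\<close>

lemma orbit_double: "orbit (2 * x) = shift (orbit x)"
  using orbit_power[of 1 x] by (auto simp: shift_def orbit_def fun_eq_iff)

section \<open>The probability space and the deterministic U-statistic\<close>

text \<open>The uniform distribution on \<open>[0, 1)\<close>, carried by the constant functions in order to live
  on \<open>nat \<Rightarrow> real\<close>.\<close>

definition unif :: "(nat \<Rightarrow> real) measure" where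
  "unif = distr (uniform_measure lborel {0..<1}) (\<Pi>\<^sub>M i\<in>UNIV. borel) (\<lambda>x _. x)"

lemma measurable_const_fun:
  "(\<lambda>x _. x) \<in> uniform_measure lborel {0..<1 :: real} \<rightarrow>\<^sub>M (\<Pi>\<^sub>M i\<in>(UNIV :: nat set). borel)"
  by (rule measurable_PiM_single') auto

lemma space_unif [simp]: "space unif = UNIV"
  by (simp add: unif_def space_PiM PiE_UNIV_domain)

lemma measurable_unif_0 [measurable]: "(\<lambda>\<omega>. \<omega> 0) \<in> borel_measurable unif"
  unfolding unif_def measurable_distr_eq1 by (rule measurable_component_singleton) simp

interpretation unif: prob_space unif
  unfolding unif_def
  by (rule prob_space.prob_space_distr[OF prob_space_uniform_measure measurable_const_fun]) simp_all

text \<open>A constant function is given by its value at 0, so coordinate 0 is uniform.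
  Probabilities of the process reduce to Lebesgue measure this way.\<close>

lemma measure_unif:
  assumes [measurable]: "B \<in> sets borel"
  shows "measure unif {\<omega>. \<omega> 0 \<in> B} = measure lborel ({0..<1} \<inter> B)"
proof -
  have "{\<omega>. \<omega> 0 \<in> B} \<in> sets unif"
    using measurable_sets[OF measurable_unif_0 assms] by (simp add: vimage_def)
  then have "measure unif {\<omega>. \<omega> 0 \<in> B} = measure (uniform_measure lborel {0..<1}) B"
    using measure_distr[OF measurable_const_fun, of "{\<omega>. \<omega> 0 \<in> B}"]
    by (simp only: unif_def sets_distr vimage_def mem_Collect_eq space_uniform_measure
        space_lborel space_borel Int_UNIV_right Collect_mem_eq)
  then show ?thesis by simp
qed

lemma AE_unif_irrational: "AE \<omega> in unif. \<omega> 0 \<notin> \<rat>"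
proof -
  have null: "\<rat> \<in> null_sets (lborel :: real measure)"
    by (intro countable_imp_null_set_lborel countable_rat)
  then have Rats: "(\<rat> :: real set) \<in> sets borel"
    by (metis null_setsD2 sets_lborel)
  have "emeasure lborel ({0..<1} \<inter> (\<rat> :: real set)) = 0"
    using null_setsD1[OF null_set_Int2[OF null, of "{0..<1}"]] by (simp add: Int_commute)
  then have "measure lborel ({0..<1} \<inter> (\<rat> :: real set)) = 0"
    by (simp add: measure_def)
  then have "measure unif {\<omega>. \<omega> 0 \<in> \<rat>} = 0"
    by (simp add: measure_unif[OF Rats])
  then show ?thesis
    using measurable_sets[OF measurable_unif_0 Rats]
    by (intro AE_I[where N = "{\<omega>. \<omega> 0 \<in> \<rat>}"]) (auto simp: vimage_def unif.emeasure_eq_measure)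
qed

definition doubling_process :: "nat \<Rightarrow> (nat \<Rightarrow> real) \<Rightarrow> real" where
  "doubling_process i \<omega> = orbit_coordinate i (\<omega> 0)"

text \<open>Along an irrational orbit the kernel depends on \<open>j - i\<close> alone, so the sum
  is a count free of \<open>\<omega>\<close>. Both sides share the denominator, which covers
  \<open>n < 2\<close> as well.\<close>

lemma U_statistic_unif:
  assumes "\<omega> 0 \<notin> \<rat>"
  shows "U_statistic orbit_kernel doubling_process n \<omega> = block_density n"
proof -
  have "(\<Sum>(i, j)\<in>pairs n. orbit_kernel (orbit_coordinate i (\<omega> 0)) (orbit_coordinate j (\<omega> 0)))
      = (\<Sum>(i, j)\<in>pairs n. if j - i \<in> blocks then 1 else 0)"
    using orbit_kernel_orbit[OF assms] by (intro sum.cong) (auto simp: pairs_def)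
  also have "\<dots> = real (card {(i, j) \<in> pairs n. j - i \<in> blocks})"
    by (simp add: case_prod_unfold sum.If_cases Int_def)
  finally show ?thesis
    by (simp add: U_statistic_def block_density_def pairs_def doubling_process_def)
qed

text \<open>If \<open>u m\<close> and \<open>u n\<close> were more than
  \<open>2 * \<epsilon>\<close> apart, no value of \<open>Z\<close> could be within
  \<open>\<epsilon>\<close> of both. The two exceptional events would then cover almost everything,
  although each has probability below \<open>1 / 2\<close>.\<close>

lemma (in prob_space) tendsto_in_probability_deterministic_close:
  assumes conv: "tendsto_in_probability M Y Z"
    and [measurable]: "Z \<in> borel_measurable M" "\<And>n. Y n \<in> borel_measurable M"
    and det: "\<And>n. AE \<omega> in M. Y n \<omega> = u n" and "\<epsilon> > 0"
  shows "\<exists>N. \<forall>m\<ge>N. \<forall>n\<ge>N. \<bar>u m - u n\<bar> \<le> 2 * \<epsilon>"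
proof -
  have "\<forall>\<^sub>F n in sequentially. measure M {\<omega> \<in> space M. \<bar>Y n \<omega> - Z \<omega>\<bar> > \<epsilon>} < 1 / 2"
    using conv \<open>\<epsilon> > 0\<close> unfolding tendsto_in_probability_def by (intro order_tendstoD(2)) auto
  then obtain N where N: "measure M {\<omega> \<in> space M. \<bar>Y n \<omega> - Z \<omega>\<bar> > \<epsilon>} < 1 / 2" if "n \<ge> N" for n
    unfolding eventually_sequentially by blast
  have "\<bar>u m - u n\<bar> \<le> 2 * \<epsilon>" if "m \<ge> N" "n \<ge> N" for m n
  proof (rule ccontr)
    assume far: "\<not> \<bar>u m - u n\<bar> \<le> 2 * \<epsilon>"
    let ?E = "\<lambda>n. {\<omega> \<in> space M. \<bar>Y n \<omega> - Z \<omega>\<bar> > \<epsilon>}"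
    have "AE \<omega> in M. \<omega> \<in> ?E m \<union> ?E n"
      using det[of m] det[of n] AE_space by eventually_elim (use far in auto)
    then have "1 = measure M (?E m \<union> ?E n)"
      by (subst prob_eq_1[THEN iffD2]) auto
    also have "\<dots> \<le> measure M (?E m) + measure M (?E n)"
      by (intro measure_Un_le) auto
    finally show False using N[OF that(1)] N[OF that(2)] by linarith
  qed
  then show ?thesis by blast
qed

section \<open>Stationarity and ergodicity of the doubling process\<close>

lemma random_sequence_doubling: "random_sequence unif doubling_process"
  unfolding random_sequence_def doubling_process_def[abs_def] by measurable

lemma trajectory_doubling:
  "trajectory (\<lambda>i. doubling_process (i + k)) \<omega> = orbit (2 ^ k * \<omega> 0)"
  by (simp add: trajectory_def doubling_process_def orbit_power)

lemma trajectory_doubling_0: "trajectory doubling_process \<omega> = orbit (\<omega> 0)"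
  using trajectory_doubling[of 0] by simp

lemma orbit_vimage_borel: "A \<in> sets trajectory_space \<Longrightarrow> {x. orbit x \<in> A} \<in> sets borel"
  using measurable_sets[OF measurable_orbit] by (simp add: vimage_def)

lemma strictly_stationary_doubling: "strictly_stationary unif doubling_process"
  unfolding strictly_stationary_def
proof
  fix k
  \<comment> \<open>The right-hand side is free of \<open>m\<close>; comparing \<open>m = k\<close>
    with \<open>m = 0\<close> gives equality of the two laws.\<close>
  have law: "measure unif {\<omega>. trajectory (\<lambda>i. doubling_process (i + m)) \<omega> \<in> A}
      = measure lborel ({0..<1} \<inter> {x. orbit x \<in> A})" if A: "A \<in> sets trajectory_space" for m A
  proof -
    have orbit_scaled: "(\<lambda>x. orbit (2 ^ m * x)) \<in> borel \<rightarrow>\<^sub>M trajectory_space"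
      by (rule measurable_compose[OF _ measurable_orbit]) simp
    have "measure unif {\<omega>. trajectory (\<lambda>i. doubling_process (i + m)) \<omega> \<in> A}
        = measure unif {\<omega>. \<omega> 0 \<in> {x. 2 ^ m * x \<in> {x. orbit x \<in> A}}}"
      by (simp add: trajectory_doubling)
    also have "\<dots> = measure lborel ({0..<1} \<inter> {x. 2 ^ m * x \<in> {x. orbit x \<in> A}})"
      using measurable_sets[OF orbit_scaled A] by (intro measure_unif) (simp add: vimage_def)
    also have "\<dots> = measure lborel ({0..<1} \<inter> {x. orbit x \<in> A})"
      using orbit_vimage_borel[OF A] by (intro measure_periodic_power) (simp_all add: orbit_add_1)
    finally show ?thesis .
  qed
  show "distr unif trajectory_space (trajectory (\<lambda>i. doubling_process (i + k)))
      = distr unif trajectory_space (trajectory doubling_process)"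
  proof (rule measure_eqI)
    fix A assume "A \<in> sets (distr unif trajectory_space (trajectory (\<lambda>i. doubling_process (i + k))))"
    then have A: "A \<in> sets trajectory_space" by simp
    show "emeasure (distr unif trajectory_space (trajectory (\<lambda>i. doubling_process (i + k)))) A
        = emeasure (distr unif trajectory_space (trajectory doubling_process)) A"
      using law[OF A, of k] law[OF A, of 0] A measurable_trajectory[OF random_sequence_doubling]
      by (simp add: emeasure_distr vimage_def unif.emeasure_eq_measure)
  qed simp
qed

lemma ergodic_sequence_doubling: "ergodic_sequence unif doubling_process"
  unfolding ergodic_sequence_def
proof (intro ballI impI)
  fix A assume A: "A \<in> sets trajectory_space" and inv: "shift -` A \<inter> space trajectory_space = A"
  have "orbit (2 * x) \<in> A \<longleftrightarrow> orbit x \<in> A" for x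
  proof -
    \<comment> \<open>The hypothesis \<open>inv\<close> describes the preimage only inside the
      space, so membership of the orbit is needed to apply it.\<close>
    have "orbit x \<in> space trajectory_space"
      using measurable_space[OF measurable_orbit] by simp
    then show ?thesis using inv by (auto simp: orbit_double)
  qed
  then have "measure lborel ({0..<1} \<inter> {x. orbit x \<in> A}) \<in> {0, 1}"
    using orbit_vimage_borel[OF A] by (intro doubling_ergodic) (simp_all add: orbit_add_1)
  then show "measure unif {\<omega> \<in> space unif. trajectory doubling_process \<omega> \<in> A} \<in> {0, 1}"
    using measure_unif[OF orbit_vimage_borel[OF A]] by (simp add: trajectory_doubling_0)
qed

theorem proposition4p1:
  shows "\<exists>(M :: (nat \<Rightarrow> real) measure) (X :: nat \<Rightarrow> (nat \<Rightarrow> real) \<Rightarrow> real) (h :: real \<Rightarrow> real \<Rightarrow> real).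
    prob_space M \<and>
    random_sequence M X \<and> strictly_stationary M X \<and> ergodic_sequence M X \<and>
    (\<lambda>(x, y). h x y) \<in> borel_measurable (borel \<Otimes>\<^sub>M borel) \<and>
    (\<exists>B. \<forall>x y. \<bar>h x y\<bar> \<le> B) \<and>
    (\<forall>x y. h x y = h y x) \<and>
    \<not> (\<exists>Z. Z \<in> borel_measurable M \<and> tendsto_in_probability M (U_statistic h X) Z)"
proof (intro exI conjI)
  show "prob_space unif" by (rule unif.prob_space_axioms)
  show "random_sequence unif doubling_process" by (rule random_sequence_doubling)
  show "strictly_stationary unif doubling_process" by (rule strictly_stationary_doubling)
  show "ergodic_sequence unif doubling_process" by (rule ergodic_sequence_doubling)
  show "(\<lambda>(x, y). orbit_kernel x y) \<in> borel_measurable (borel \<Otimes>\<^sub>M borel)" by measurable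
  show "\<forall>x y. \<bar>orbit_kernel x y\<bar> \<le> 1" by (simp add: orbit_kernel_def)
  show "\<forall>x y. orbit_kernel x y = orbit_kernel y x"
    unfolding orbit_kernel_def by (intro allI if_cong) auto
  show "\<not> (\<exists>Z. Z \<in> borel_measurable unif \<and>
      tendsto_in_probability unif (U_statistic orbit_kernel doubling_process) Z)"
  proof clarify
    fix Z assume Z: "Z \<in> borel_measurable unif"
      "tendsto_in_probability unif (U_statistic orbit_kernel doubling_process) Z"
    have "(\<lambda>\<omega>. orbit_kernel (doubling_process i \<omega>) (doubling_process j \<omega>)) \<in> borel_measurable unif" for i j
    proof -
      have "(\<lambda>\<omega>. (doubling_process i \<omega>, doubling_process j \<omega>)) \<in> unif \<rightarrow>\<^sub>M borel \<Otimes>\<^sub>M borel"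
        unfolding doubling_process_def by measurable
      from measurable_compose[OF this measurable_orbit_kernel] show ?thesis by simp
    qed
    then have meas: "U_statistic orbit_kernel doubling_process n \<in> borel_measurable unif" for n
      unfolding U_statistic_def[abs_def] case_prod_unfold
      by (intro borel_measurable_divide borel_measurable_sum) auto
    have "AE \<omega> in unif. U_statistic orbit_kernel doubling_process n \<omega> = block_density n" for n
      using AE_unif_irrational by eventually_elim (rule U_statistic_unif)
    \<comment> \<open>The choice \<open>1 / 8\<close> keeps late densities within
      \<open>1 / 4\<close> of each other, less than the gap between \<open>3 / 4\<close> and
      \<open>1 / 4\<close>.\<close>
    then obtain N where N: "\<bar>block_density m - block_density n\<bar> \<le> 2 * (1 / 8)" if "m \<ge> N" "n \<ge> N" for m n
      using unif.tendsto_in_probability_deterministic_close[OF Z(2,1) meas, of block_density "1 / 8"]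
      by auto
    have le_power: "n \<le> 10 ^ Suc n" for n :: nat
      using less_exp[of "Suc n"] power_mono[of 2 "10 :: nat" "Suc n"] by linarith
    \<comment> \<open>Exponents of opposite parity give two indices beyond \<open>N\<close>, one for
      each density bound.\<close>
    have "N \<le> 10 ^ Suc (2 * N)" "N \<le> 10 ^ Suc (2 * N + 1)"
      using le_power[of "2 * N"] le_power[of "2 * N + 1"] by linarith+
    then have "\<bar>block_density (10 ^ Suc (2 * N)) - block_density (10 ^ Suc (2 * N + 1))\<bar> \<le> 2 * (1 / 8)"
      by (rule N)
    moreover have "block_density (10 ^ Suc (2 * N)) \<ge> 3 / 4"
      by (rule block_density_even) simp
    moreover have "block_density (10 ^ Suc (2 * N + 1)) \<le> 1 / 4"
      by (rule block_density_odd) simp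
    ultimately show False by linarith
  qed
qed

end
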